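(* Let $1\le k\le n$, and let $f$ be a real-valued differentiable function defined on a neighborhood $\mathrm{St}_\delta(k,n)$ of the Stiefel manifold $\mathrm{St}(k,n)$, with Euclidean gradient $\mathcal{H}(P)=\partial f(P)/\partial P\in\mathbb{R}^{n\times k}$. Let $P_*\in\mathrm{St}(k,n)$ be a maximizer of $\max_{P\in\mathrm{St}(k,n)} f(P)$. Suppose that the NPDo Ansatz holds for $f$ with a subset $\mathbb{P}\subseteq\mathrm{St}(k,n)$ and that $P_*\in\mathbb{P}$. Then $$\mathcal{H}(P_* )=P_*\Lambda_*\quad\text{with}\quad \Lambda_*:=P_*^{\mathrm T}\mathcal{H}(P_* )\succeq 0 .$$
   Context: $\mathrm{St}(k,n)=\{P\in\mathbb{R}^{n\times k}: P^{\mathrm T}P=I_k\}$; $\mathrm{St}_\delta(k,n)=\{P\in\mathbb{R}^{n\times k}:\|P^{\mathrm T}P-I_k\|<\delta\}$ for some constant $\delta>0$ and some matrix norm. The Euclidean gradient $\partial f(P)/\partial P$ is the $n\times k$ matrix of partial derivatives $\partial f/\partial p_{ij}$, all entries of $P$ being treated as independent. $A\succeq 0$ means that $A$ is symmetric positive semidefinite. NPDo Ansatz (for $f$ with a subset $\mathbb{P}\subseteq\mathrm{St}(k,n)$): there is a constant $\omega>0$ (independent of $P$ and $\widehat P$) such that whenever $P\in\mathbb{P}$, $\widehat P\in\mathrm{St}(k,n)$ and $\eta\in\mathbb{R}$ satisfy $$\mathrm{tr}(\widehat P^{\mathrm T}\mathcal{H}(P))\ge \mathrm{tr}(P^{\mathrm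 T}\mathcal{H}(P))+\eta,$$ there exists $Q\in\mathrm{St}(k,k)$ such that $\widetilde P=\widehat PQ\in\mathbb{P}$ and $f(\widetilde P)\ge f(P)+\omega\eta$. *)

theory Defs
  imports "HOL-Analysis.Analysis"
begin

text \<open>
  An \<open>n \<times> k\<close> real matrix has type \<open>real ^ 'k ^ 'n\<close>, with
  \<open>n = CARD('n)\<close>, \<open>k = CARD('k)\<close> and \<open>P $ i $ j\<close> the entry in row \<open>i\<close>, column \<open>j\<close>.
\<close>

definition stiefel :: "(real ^ 'k ^ 'n) set" where
  "stiefel = {P. transpose P ** P = mat 1}"

text \<open>Submultiplicativity is deliberately not required, so every convention for matrix norms
  is covered.\<close>

definition matrix_norm :: "(real ^ 'k ^ 'n \<Rightarrow> real) \<Rightarrow> bool" where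
  "matrix_norm \<nu> \<longleftrightarrow>
     (\<forall>A. 0 \<le> \<nu> A) \<and>
     (\<forall>A. \<nu> A = 0 \<longleftrightarrow> A = 0) \<and>
     (\<forall>c A. \<nu> (c *\<^sub>R A) = \<bar>c\<bar> * \<nu> A) \<and>
     (\<forall>A B. \<nu> (A + B) \<le> \<nu> A + \<nu> B)"

definition stiefel_nbhd :: "(real ^ 'k ^ 'k \<Rightarrow> real) \<Rightarrow> real \<Rightarrow> (real ^ 'k ^ 'n) set" where
  "stiefel_nbhd \<nu> \<delta> = {P. \<nu> (transpose P ** P - mat 1) < \<delta>}"

text \<open>The matrix of partial derivatives; \<open>axis i (axis j 1)\<close> is the matrix whose only nonzero
  entry is a \<open>1\<close> at position \<open>(i, j)\<close>.\<close>

definition euclidean_gradient :: "(real ^ 'k ^ 'n \<Rightarrow> real) \<Rightarrow> real ^ 'k ^ 'n \<Rightarrow> real ^ 'k ^ 'n" where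
  "euclidean_gradient f P = (\<chi> i j. deriv (\<lambda>t. f (P + t *\<^sub>R axis i (axis j 1))) 0)"

definition pos_semidef :: "real ^ 'k ^ 'k \<Rightarrow> bool" where
  "pos_semidef A \<longleftrightarrow> transpose A = A \<and> (\<forall>x. 0 \<le> x \<bullet> (A *v x))"

definition NPDo_Ansatz :: "(real ^ 'k ^ 'n \<Rightarrow> real) \<Rightarrow> (real ^ 'k ^ 'n) set \<Rightarrow> bool" where
  "NPDo_Ansatz f \<PP> \<longleftrightarrow>
     (\<exists>\<omega>>0. \<forall>P \<in> \<PP>. \<forall>P' \<in> stiefel. \<forall>\<eta>::real.
        trace (transpose P' ** euclidean_gradient f P)
          \<ge> trace (transpose P ** euclidean_gradient f P) + \<eta> \<longrightarrow>
        (\<exists>Q \<in> (stiefel :: (real ^ 'k ^ 'k) set).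
           P' ** Q \<in> \<PP> \<and> f (P' ** Q) \<ge> f P + \<omega> * \<eta>))"

end

theory Submission
  imports Defs
begin

text \<open>
  Write \<open>H\<close> for the gradient at \<open>P0\<close>. If some \<open>P'\<close> on the Stiefel manifold had a larger trace product
  with \<open>H\<close> than \<open>P0\<close>, the Ansatz would produce a point of the manifold with a value of \<open>f\<close> larger
  than the maximum \<open>f P0\<close>. So \<open>P0\<close> maximizes the linear functional \<open>P \<mapsto> tr (P\<^sup>T H)\<close>. Testing this
  against \<open>P' = U\<^sup>T P0\<close> with \<open>U\<close> orthogonal shows that \<open>M = H P0\<^sup>T\<close> maximizes \<open>tr (U M)\<close> at \<open>U = I\<close>.
  Taking for \<open>U\<close> one reflection gives \<open>x\<^sup>T M x \<ge> 0\<close>, and taking products of two reflections (plane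
  rotations) gives \<open>M = M\<^sup>T\<close>. Multiplying \<open>H P0\<^sup>T = P0 H\<^sup>T\<close> by \<open>P0\<close> yields the claim.
\<close>

text \<open>The Householder reflection in the hyperplane orthogonal to \<open>v\<close>. Since
  \<open>x / 0 = 0\<close>, it is the identity for \<open>v = 0\<close>, so it is orthogonal for
  every \<open>v\<close>.\<close>

definition reflect_along :: "'a::real_inner \<Rightarrow> 'a \<Rightarrow> 'a" where
  "reflect_along v x = x - (2 * (x \<bullet> v) / (v \<bullet> v)) *\<^sub>R v"

lemma linear_reflect_along: "linear (reflect_along v)"
  by (rule linearI) (simp_all add: reflect_along_def inner_simps algebra_simps add_divide_distrib)

lemma orthogonal_transformation_reflect_along: "orthogonal_transformation (reflect_along v)"
  by (simp add: orthogonal_transformation_def linear_reflect_along)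
     (simp add: reflect_along_def inner_simps inner_commute field_simps)

text \<open>The reflection has the matrix I - 2 v v^T / (v^T v), and the trace of v v^T M is v^T M
  v.\<close>

lemma trace_reflect_along:
  fixes M :: "real ^ 'n ^ 'n" and v :: "real ^ 'n"
  shows "trace (matrix (reflect_along v) ** M) = trace M - 2 * (v \<bullet> (M *v v)) / (v \<bullet> v)"
proof -
  have tr: "trace A = (\<Sum>i\<in>UNIV. (A *v axis i 1) $ i)" for A :: "real ^ 'n ^ 'n"
    by (simp add: trace_def matrix_vector_mult_basis column_def)
  have "trace (matrix (reflect_along v) ** M) = (\<Sum>i\<in>UNIV. reflect_along v (M *v axis i 1) $ i)"
    unfolding tr by (simp add: linear_reflect_along flip: matrix_vector_mul_assoc)
  also have "\<dots> = trace M - (2 / (v \<bullet> v)) * (\<Sum>i\<in>UNIV. ((M *v axis i 1) \<bullet> v) * v $ i)"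
    unfolding tr by (simp add: reflect_along_def sum_subtractf sum_distrib_left mult_ac)
  also have "(\<Sum>i\<in>UNIV. ((M *v axis i 1) \<bullet> v) * v $ i) = (M *v (\<Sum>i\<in>UNIV. v $ i *\<^sub>R axis i 1)) \<bullet> v"
    by (simp add: linear_sum[OF matrix_vector_mul_linear] matrix_vector_mult_scaleR inner_sum_left mult_ac)
  also have "(\<Sum>i\<in>UNIV. v $ i *\<^sub>R axis i 1) = v"
    using basis_expansion[of v] by (simp add: scalar_mult_eq_scaleR)
  finally show ?thesis by (simp add: inner_commute)
qed

lemma linear_le_quadratic_imp_zero:
  fixes a b :: real
  assumes "\<And>t. t * b \<le> t\<^sup>2 * a"
  shows "b = 0"
proof -
  \<comment> \<open>A positive number strictly above \<open>a\<close>: testing at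
    \<open>t = b / c\<close> gives \<open>b\<^sup>2 * c \<le> b\<^sup>2 * a\<close>, which forces
    \<open>b = 0\<close>.\<close>
  define c where "c = \<bar>a\<bar> + 1"
  have c: "c > 0" "a < c" by (auto simp: c_def)
  have "b / c * b \<le> (b / c)\<^sup>2 * a" by (rule assms)
  then have "b\<^sup>2 * c \<le> b\<^sup>2 * a"
    using c by (simp add: field_simps power2_eq_square)
  then show ?thesis
    using c by (metis mult_le_cancel_left_pos not_less zero_less_power2)
qed

lemma pos_semidef_if_trace_maximal:
  fixes M :: "real ^ 'n ^ 'n"
  assumes max: "\<And>U. orthogonal_matrix U \<Longrightarrow> trace (U ** M) \<le> trace M"
  shows "pos_semidef M"
proof -
  define R :: "real ^ 'n \<Rightarrow> real ^ 'n ^ 'n" where "R v = matrix (reflect_along v)" for v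
  have orth: "orthogonal_matrix (R v)" for v
    using orthogonal_transformation_reflect_along[of v]
    by (simp add: R_def orthogonal_transformation_matrix)
  have nonneg: "0 \<le> x \<bullet> (M *v x)" for x
  proof (cases "x = 0")
    case False
    have "trace M - 2 * (x \<bullet> (M *v x)) / (x \<bullet> x) \<le> trace M"
      using max[OF orth[of x]] by (simp add: R_def trace_reflect_along)
    with False show ?thesis by (auto simp: zero_le_divide_iff dest: antisym[OF _ inner_ge_zero])
  qed simp
  have sym: "M $ i $ j = M $ j $ i" if "i \<noteq> j" for i j
  proof -
    let ?a = "axis i 1 :: real ^ 'n" and ?b = "axis j 1 :: real ^ 'n"
    have entry: "axis p 1 \<bullet> (M *v axis q 1) = M $ p $ q" for p q
      by (simp add: matrix_vector_mult_basis column_def inner_axis')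
    \<comment> \<open>With \<open>v = ?a + t *\<^sub>R ?b\<close>, the product
      \<open>R ?a ** R v\<close> is a rotation in the plane of \<open>?a\<close> and
      \<open>?b\<close> and is the identity at \<open>t = 0\<close>. To first order in
      \<open>t\<close>, the change of the trace is a multiple of the antisymmetric part of
      \<open>M\<close>.\<close>
    have "t * (M $ j $ i - M $ i $ j) \<le> t\<^sup>2 * (M $ i $ i + M $ j $ j)" for t
    proof -
      define v where "v = ?a + t *\<^sub>R ?b"
      define d where "d = 1 + t\<^sup>2"
      have d: "d > 0" by (simp add: d_def add_pos_nonneg)
      have vv: "v \<bullet> v = d" and av: "?a \<bullet> v = 1"
        using that by (simp_all add: v_def d_def inner_axis_axis inner_simps power2_eq_square)
      have vMv: "v \<bullet> (M *v v) = M $ i $ i + t * (M $ i $ j + M $ j $ i) + t\<^sup>2 * M $ j $ j"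
        by (simp add: v_def matrix_vector_right_distrib matrix_vector_mult_scaleR inner_simps entry
              power2_eq_square algebra_simps)
      have vMa: "v \<bullet> (M *v ?a) = M $ i $ i + t * M $ j $ i"
        by (simp add: v_def inner_simps entry)
      have RMa: "(R v ** M) *v ?a = M *v ?a - (2 * ((M *v ?a) \<bullet> v) / d) *\<^sub>R v"
        by (simp add: R_def linear_reflect_along reflect_along_def vv flip: matrix_vector_mul_assoc)
      have "trace (R ?a ** (R v ** M)) \<le> trace M"
        using max[OF orthogonal_matrix_mul[OF orth orth]] by (simp add: matrix_mul_assoc)
      \<comment> \<open>The trace formula is used twice: here for the outer reflection, applied to
        \<open>R v ** M\<close>, and then for the inner one, applied to \<open>M\<close>.\<close>
      also have "trace (R ?a ** (R v ** M)) = trace (R v ** M) - 2 * (?a \<bullet> ((R v ** M) *v ?a))"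
        using trace_reflect_along[of ?a "R v ** M"] by (simp add: R_def inner_axis_axis)
      also have "?a \<bullet> ((R v ** M) *v ?a) = M $ i $ i - 2 * (M $ i $ i + t * M $ j $ i) / d"
        unfolding RMa inner_diff_right inner_scaleR_right av entry
        using vMa by (simp add: inner_commute)
      also have "trace (R v ** M) = trace M - 2 * (v \<bullet> (M *v v)) / d"
        using trace_reflect_along[of v M] by (simp add: R_def vv)
      finally have "(2 * (M $ i $ i + t * M $ j $ i) - v \<bullet> (M *v v)) / d \<le> M $ i $ i"
        by (simp add: diff_divide_distrib add_divide_distrib)
      then have "2 * (M $ i $ i + t * M $ j $ i) - v \<bullet> (M *v v) \<le> M $ i $ i * d"
        using d by (simp add: pos_divide_le_eq)
      then show ?thesis
        unfolding vMv d_def by (simp add: algebra_simps)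
    qed
    from linear_le_quadratic_imp_zero[OF this] show ?thesis by simp
  qed
  have "transpose M = M"
    unfolding vec_eq_iff transpose_def by (simp, metis sym)
  with nonneg show ?thesis by (simp add: pos_semidef_def)
qed

lemma stiefel_orthogonal_mult:
  assumes "P \<in> stiefel" and "orthogonal_matrix U"
  shows "U ** P \<in> stiefel"
proof -
  have "transpose (U ** P) ** (U ** P) = transpose P ** ((transpose U ** U) ** P)"
    by (simp add: matrix_transpose_mul matrix_mul_assoc)
  with assms show ?thesis by (simp add: stiefel_def orthogonal_matrix)
qed

text \<open>Varying \<open>P0\<close> by orthogonal factors on the left makes the larger matrix
  \<open>H ** transpose P0\<close> symmetric. This also forces the columns of \<open>H\<close> into
  the column space of \<open>P0\<close>.\<close>

lemma polar_if_trace_maximal_on_stiefel: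
  fixes P0 H :: "real ^ 'k ^ 'n"
  assumes P0: "P0 \<in> stiefel"
    and max: "\<And>P. P \<in> stiefel \<Longrightarrow> trace (transpose P ** H) \<le> trace (transpose P0 ** H)"
  shows "H = P0 ** (transpose P0 ** H)" and "pos_semidef (transpose P0 ** H)"
proof -
  define M where "M = H ** transpose P0"
  have PP: "transpose P0 ** P0 = mat 1" using P0 by (simp add: stiefel_def)
  have M: "pos_semidef M"
  proof (rule pos_semidef_if_trace_maximal)
    fix U :: "real ^ 'n ^ 'n"
    assume "orthogonal_matrix U"
    \<comment> \<open>The transpose makes the cyclic trace identity produce
      \<open>U ** M\<close>.\<close>
    then have "transpose U ** P0 \<in> stiefel"
      using P0 by (simp add: stiefel_orthogonal_mult orthogonal_matrix_transpose)
    from max[OF this] show "trace (U ** M) \<le> trace M"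
      by (simp add: M_def matrix_transpose_mul matrix_mul_assoc trace_mul_sym[of _ "transpose P0"])
  qed
  have HP: "M ** P0 = H"
    by (simp add: M_def PP flip: matrix_mul_assoc)
  have "transpose M = M" using M by (simp add: pos_semidef_def)
  then have sym: "P0 ** transpose H = M"
    by (simp add: M_def matrix_transpose_mul)
  have \<Lambda>: "transpose P0 ** H = transpose H ** P0"
    by (metis HP PP sym matrix_mul_assoc matrix_mul_lid)
  show "H = P0 ** (transpose P0 ** H)"
    unfolding \<Lambda> by (simp add: matrix_mul_assoc sym HP)
  \<comment> \<open>As \<open>H = M ** P0\<close>, the matrix \<open>transpose P0 ** H\<close> is a
    congruence of \<open>M\<close> and inherits its semidefiniteness.\<close>
  have "x \<bullet> ((transpose P0 ** H) *v x) = (P0 *v x) \<bullet> (M *v (P0 *v x))" for x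
  proof -
    have "x \<bullet> ((transpose P0 ** H) *v x) = (x v* transpose P0) \<bullet> (H *v x)"
      by (simp only: dot_lmul_matrix matrix_vector_mul_assoc)
    also have "\<dots> = (P0 *v x) \<bullet> (M *v (P0 *v x))"
      by (simp add: vector_transpose_matrix matrix_vector_mul_assoc HP)
    finally show ?thesis .
  qed
  moreover have "transpose (transpose P0 ** H) = transpose P0 ** H"
    using \<Lambda> by (simp add: matrix_transpose_mul)
  ultimately show "pos_semidef (transpose P0 ** H)"
    using M by (simp add: pos_semidef_def)
qed

theorem theorem3p1:
  fixes f :: "real ^ 'k ^ 'n \<Rightarrow> real"
    and \<nu> :: "real ^ 'k ^ 'k \<Rightarrow> real"
    and \<delta> :: real
    and \<PP> :: "(real ^ 'k ^ 'n) set"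
    and P0 :: "real ^ 'k ^ 'n"
  assumes "CARD('k) \<le> CARD('n)"
    and "matrix_norm \<nu>"
    and "\<delta> > 0"
    and "f differentiable_on stiefel_nbhd \<nu> \<delta>"
    and "P0 \<in> stiefel"
    and "\<And>P. P \<in> stiefel \<Longrightarrow> f P \<le> f P0"
    and "\<PP> \<subseteq> stiefel"
    and "NPDo_Ansatz f \<PP>"
    and "P0 \<in> \<PP>"
  shows "let \<Lambda> = transpose P0 ** euclidean_gradient f P0
         in euclidean_gradient f P0 = P0 ** \<Lambda> \<and> pos_semidef \<Lambda>"
proof -
  let ?H = "euclidean_gradient f P0"
  have max: "trace (transpose P ** ?H) \<le> trace (transpose P0 ** ?H)" if "P \<in> stiefel" for P
  proof -
    \<comment> \<open>The largest \<open>\<eta>\<close> that the premise of the Ansatz admits for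
      this \<open>P\<close>.\<close>
    define \<eta> where "\<eta> = trace (transpose P ** ?H) - trace (transpose P0 ** ?H)"
    obtain \<omega> where \<omega>: "\<omega> > 0" and ansatz:
      "\<forall>P\<in>\<PP>. \<forall>P'\<in>stiefel. \<forall>\<eta>. trace (transpose P' ** euclidean_gradient f P)
          \<ge> trace (transpose P ** euclidean_gradient f P) + \<eta> \<longrightarrow>
        (\<exists>Q \<in> (stiefel :: (real ^ 'k ^ 'k) set). P' ** Q \<in> \<PP> \<and> f (P' ** Q) \<ge> f P + \<omega> * \<eta>)"
      using assms(8) unfolding NPDo_Ansatz_def by blast
    have "trace (transpose P ** ?H) \<ge> trace (transpose P0 ** ?H) + \<eta>" by (simp add: \<eta>_def)
    with ansatz assms(9) that obtain Q :: "real ^ 'k ^ 'k"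
      where "P ** Q \<in> \<PP>" and "f (P ** Q) \<ge> f P0 + \<omega> * \<eta>" by blast
    \<comment> \<open>The point \<open>P ** Q\<close> lies in \<open>\<PP>\<close>, hence on the
      manifold, where \<open>f P0\<close> is the maximum.\<close>
    moreover from this assms(6,7) have "f (P ** Q) \<le> f P0" by blast
    ultimately have "\<omega> * \<eta> \<le> 0" by linarith
    with \<omega> have "\<eta> \<le> 0" by (simp add: mult_le_0_iff)
    then show ?thesis by (simp add: \<eta>_def)
  qed
  show ?thesis
    unfolding Let_def using polar_if_trace_maximal_on_stiefel[OF assms(5) max] by blast
qed

end
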